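(* Let $d>1$ be an integer. There are constants $c,C>0$ depending only on $d$ such that for every finite nonempty monotone index set $\Lambda\subset\mathbb{N}^d$ the best (smallest) constant $C_\Lambda$ for which $$\Big\|\sum_{\beta\in\Lambda}s_\beta\Big\|_{H_0^1}^2\le C_\Lambda\sum_{\beta\in\Lambda}2^{2|\beta|_\infty}\|s_\beta\|_{L_2}^2$$ holds for all choices of $s_\beta\in S_\beta$, $\beta\in\Lambda$, satisfies $$c\,n_\Lambda\le C_\Lambda\le C\,n_\Lambda,\qquad n_\Lambda:=\max_{1\le k\le k_\Lambda}|\Lambda_k|,$$ where $k_\Lambda=\max_{\beta\in\Lambda}|\beta|_\infty$ and $\Lambda_k=\{\beta\in\Lambda:\ |\beta|_\infty=k\}$.
   Context: Notation: $\mathbb{N}=\{1,2,3,\dots\}$, $I=[0,1]$, $I^d$ is the $d$-dimensional unit cube, $L_2=L_2(I^d)$. For $\beta\in\mathbb{N}^d$, $|\beta|_\infty=\max_i\beta_i$; $\beta'\le\beta$ means $\beta'_i\le\beta_i$ for all $i$. The $H^1_0$ norm is $\|u\|_{H_0^1}^2=\int_{I^d}|\nabla u|^2\,dx$. A set $\Lambda\subset\mathbb{N}^d$ is monotone if $\beta\in\Lambda$, $\beta'\in\mathbb{N}^d$ and $\beta'\le\beta$ imply $\beta'\in\Lambda$. $|\Lambda_k|$ denotes cardinality. Faber-Schauder blocks: let $\phi(t)=(1-|t|)_+$ for $t\in\mathbb{R}$. For $k\in\mathbb{N}$ and $i=0,1,\dots,2^{k-1}-1$ put $\phi_{2^{k-1}+i}(t)=\phi(2^kt-(2i+1))$,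 $t\in[0,1]$, and let $J_k=\{2^{k-1},\dots,2^k-1\}$. For $\alpha\in\mathbb{N}^d$ put $\phi_\alpha(x)=\prod_{i=1}^d\phi_{\alpha_i}(x_i)$, and for $\beta\in\mathbb{N}^d$ put $J_\beta=J_{\beta_1}\times\dots\times J_{\beta_d}$ and $S_\beta=\mathrm{span}\{\phi_\alpha:\alpha\in J_\beta\}$. *)

theory Defs
  imports "HOL-Analysis.Analysis" "HOL-Library.Discrete_Functions"
begin

definition hat :: "real \<Rightarrow> real" where
  "hat t = max 0 (1 - \<bar>t\<bar>)"

definition level_indices :: "nat \<Rightarrow> nat set" where
  "level_indices k = {2 ^ (k - 1) .. 2 ^ k - 1}"

(* Every n \<ge> 1 is n = 2 ^ (k - 1) + i for unique k \<ge> 1 and i < 2 ^ (k - 1), namely with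
   k - 1 = floor_log n; see faber_eq. The function vanishes outside [0,1]. *)
definition faber :: "nat \<Rightarrow> real \<Rightarrow> real" where
  "faber n t = (let k = Suc (floor_log n); i = n - 2 ^ (k - 1)
                in hat (2 ^ k * t - (2 * real i + 1)))"

lemma faber_eq:
  assumes "k \<ge> 1" and "i < 2 ^ (k - 1)"
  shows "2 ^ (k - 1) + i \<in> level_indices k"
    and "faber (2 ^ (k - 1) + i) t = hat (2 ^ k * t - (2 * real i + 1))"
proof -
  obtain m where k: "k = Suc m"
    using assms(1) by (cases k) auto
  show "2 ^ (k - 1) + i \<in> level_indices k"
    using assms(2) by (auto simp: level_indices_def k)
  have "floor_log (2 ^ m + i) = m"
    using assms(2) by (intro floor_log_eqI) (auto simp: k)
  then show "faber (2 ^ (k - 1) + i) t = hat (2 ^ k * t - (2 * real i + 1))"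
    by (simp add: faber_def k Let_def)
qed

definition tensor_faber :: "('d::finite \<Rightarrow> nat) \<Rightarrow> real ^ 'd \<Rightarrow> real" where
  "tensor_faber \<alpha> x = (\<Prod>i\<in>UNIV. faber (\<alpha> i) (x $ i))"

definition block_indices :: "('d::finite \<Rightarrow> nat) \<Rightarrow> ('d \<Rightarrow> nat) set" where
  "block_indices \<beta> = {\<alpha>. \<forall>i. \<alpha> i \<in> level_indices (\<beta> i)}"

(* The linear span of the finite family (tensor_faber \<alpha>), \<alpha> in block_indices \<beta>. *)
definition block_space :: "('d::finite \<Rightarrow> nat) \<Rightarrow> (real ^ 'd \<Rightarrow> real) set" where
  "block_space \<beta> =
     {s. \<exists>a :: ('d \<Rightarrow> nat) \<Rightarrow> real. s = (\<lambda>x. \<Sum>\<alpha>\<in>block_indices \<beta>. a \<alpha> * tensor_faber \<alpha> x)}"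

definition multi_indices :: "('d::finite \<Rightarrow> nat) set" where
  "multi_indices = {\<beta>. \<forall>i. 1 \<le> \<beta> i}"

definition max_index :: "('d::finite \<Rightarrow> nat) \<Rightarrow> nat" where
  "max_index \<beta> = Max (range \<beta>)"

(* The order on multi-indices is the library's pointwise order on functions. *)
definition monotone_index_set :: "('d::finite \<Rightarrow> nat) set \<Rightarrow> bool" where
  "monotone_index_set \<Lambda> \<longleftrightarrow> \<Lambda> \<subseteq> multi_indices \<and>
     (\<forall>\<beta>\<in>\<Lambda>. \<forall>\<beta>'\<in>multi_indices. \<beta>' \<le> \<beta> \<longrightarrow> \<beta>' \<in> \<Lambda>)"

definition index_layer :: "('d::finite \<Rightarrow> nat) set \<Rightarrow> nat \<Rightarrow> ('d \<Rightarrow> nat) set" where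
  "index_layer \<Lambda> k = {\<beta>\<in>\<Lambda>. max_index \<beta> = k}"

definition top_level :: "('d::finite \<Rightarrow> nat) set \<Rightarrow> nat" where
  "top_level \<Lambda> = Max (max_index ` \<Lambda>)"

definition max_layer_card :: "('d::finite \<Rightarrow> nat) set \<Rightarrow> nat" where
  "max_layer_card \<Lambda> = Max ((\<lambda>k. card (index_layer \<Lambda> k)) ` {1..top_level \<Lambda>})"

definition unit_cube :: "(real ^ 'd::finite) set" where
  "unit_cube = cbox 0 1"

definition L2_norm :: "(real ^ 'd::finite \<Rightarrow> real) \<Rightarrow> real" where
  "L2_norm u = sqrt (LINT x:unit_cube|lebesgue. (u x)\<^sup>2)"

(* The classical gradient, unspecified where u is not differentiable. The functions it is applied
   to are Lipschitz, so it exists almost everywhere and is the weak gradient. Integrating with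
   respect to the complete measure lebesgue makes the remaining null set irrelevant. *)
definition gradient :: "(real ^ 'd::finite \<Rightarrow> real) \<Rightarrow> real ^ 'd \<Rightarrow> real ^ 'd" where
  "gradient u x = (THE g. GDERIV u x :> g)"

definition H10_norm :: "(real ^ 'd::finite \<Rightarrow> real) \<Rightarrow> real" where
  "H10_norm u = sqrt (LINT x:unit_cube|lebesgue. (norm (gradient u x))\<^sup>2)"

definition stability_constant :: "('d::finite \<Rightarrow> nat) set \<Rightarrow> real \<Rightarrow> bool" where
  "stability_constant \<Lambda> K \<longleftrightarrow>
     (\<forall>s. (\<forall>\<beta>\<in>\<Lambda>. s \<beta> \<in> block_space \<beta>) \<longrightarrow>
        (H10_norm (\<lambda>x. \<Sum>\<beta>\<in>\<Lambda>. s \<beta> x))\<^sup>2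
          \<le> K * (\<Sum>\<beta>\<in>\<Lambda>. 2 ^ (2 * max_index \<beta>) * (L2_norm (s \<beta>))\<^sup>2))"

definition best_constant :: "('d::finite \<Rightarrow> nat) set \<Rightarrow> real \<Rightarrow> bool" where
  "best_constant \<Lambda> K \<longleftrightarrow>
     stability_constant \<Lambda> K \<and> (\<forall>K'. stability_constant \<Lambda> K' \<longrightarrow> K \<le> K')"

end

theory Submission
  imports Defs
begin

text \<open>In one variable the derivatives of the Faber functions are multiples of Haar functions. They are
  orthogonal, and on a fixed level \<open>k\<close> differentiation multiplies every \<open>L\<^sub>2\<close> inner product by
  \<open>3 \<cdot> 4\<^sup>k\<close>. Hence the squared \<open>L\<^sub>2\<close> norm of the \<open>i\<close>-th partial derivative of \<open>\<Sum>\<beta>. s \<beta>\<close> equals the sum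
  over \<open>k\<close> of \<open>3 \<cdot> 4\<^sup>k\<close> times the squared norm of the partial sum over \<open>\<beta> i = k\<close>. For the upper bound,
  apply the Cauchy-Schwarz inequality with weights \<open>4 ^ (max_index \<beta> - k)\<close> to this partial sum; the
  reciprocal weights add up to at most \<open>4 / 3\<close> times the largest layer, by a geometric series.
  For the lower bound, take a largest layer \<open>k\<close> and a direction \<open>i\<close> in which at least the fraction
  \<open>1 / d\<close> of its indices satisfies \<open>\<beta> i = k\<close>, and for these \<open>\<beta>\<close> let \<open>s \<beta>\<close> be the sum of all
  basis functions of the block. These functions are nonnegative with the same mean, so they are far
  from orthogonal, and Jensen's inequality shows that Cauchy-Schwarz is sharp up to a constant.\<close>

section \<open>The univariate Faber functions\<close>

text \<open>The half-open intervals make the value a function of \<open>\<lfloor>t\<rfloor>\<close> alone, see \<open>wave_floor\<close>. This fixes the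
  derivative of the hat function at its kinks, a null set.\<close>

definition wave :: "real \<Rightarrow> real" where
  "wave t = indicator {-1..<0} t - indicator {0..<1} t"

definition faber_level :: "nat \<Rightarrow> nat" where
  "faber_level n = Suc (floor_log n)"

text \<open>In the variable \<open>2 ^ faber_level n * t\<close> the hat peaks at this odd integer
  and has half-width 1. Being an integer, it can be pulled out of a floor.\<close>

definition faber_centre :: "nat \<Rightarrow> nat" where
  "faber_centre n = 2 * (n - 2 ^ floor_log n) + 1"

definition faber_deriv :: "nat \<Rightarrow> real \<Rightarrow> real" where
  "faber_deriv n t = 2 ^ faber_level n * wave (2 ^ faber_level n * t - faber_centre n)"

lemma faber_eq_hat: "faber n t = hat (2 ^ faber_level n * t - faber_centre n)"
  by (simp add: faber_def faber_level_def faber_centre_def Let_def add.commute)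

lemma level_indices_faber_level:
  assumes "n \<in> level_indices k" "k \<ge> 1"
  shows "faber_level n = k"
proof -
  obtain m where k: "k = Suc m" using assms(2) by (cases k) auto
  have "2 ^ m \<le> n" "n < 2 * 2 ^ m"
    using assms(1) by (auto simp: level_indices_def k intro: le_less_trans)
  then have "floor_log n = m" by (intro floor_log_eqI) auto
  then show ?thesis by (simp add: k faber_level_def)
qed

section \<open>Integrals of the hat, the square wave and their dyadic rescalings\<close>

lemma hat_integrable_integral:
  "integrable lborel hat" "(LINT t|lborel. hat t) = 1"
  "integrable lborel (\<lambda>t. (hat t)\<^sup>2)" "(LINT t|lborel. (hat t)\<^sup>2) = 2 / 3"
proof -
  have cont: "continuous_on S hat" "continuous_on S (\<lambda>t. (hat t)\<^sup>2)" for S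
    unfolding hat_def by (intro continuous_intros)+
  \<comment> \<open>Inserting the indicator of the support turns an integral over the line into one
    over a compact interval, where an antiderivative on each half gives the value.\<close>
  have hat_indicator: "hat = (\<lambda>t. indicator {-1..1} t *\<^sub>R hat t)"
    and hat2_indicator: "(\<lambda>t. (hat t)\<^sup>2) = (\<lambda>t. indicator {-1..1} t *\<^sub>R (hat t)\<^sup>2)"
    by (auto simp: fun_eq_iff hat_def indicator_def)
  show i1: "integrable lborel hat"
    by (subst hat_indicator) (rule borel_integrable_compact[OF compact_Icc cont(1)])
  show i2: "integrable lborel (\<lambda>t. (hat t)\<^sup>2)"
    by (subst hat2_indicator) (rule borel_integrable_compact[OF compact_Icc cont(2)])
  have h: "((\<lambda>t. hat t) has_integral (1/2 + 1/2)) {-1..1}"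
  proof (rule has_integral_combine[of "-1" 0 1])
    have "((\<lambda>t::real. 1 + t) has_integral ((0 + 0\<^sup>2/2) - (-1 + (-1)\<^sup>2/2))) {-1..0}"
      by (rule fundamental_theorem_of_calculus)
         (auto intro!: derivative_eq_intros simp flip: has_real_derivative_iff_has_vector_derivative)
    then show "(hat has_integral (1/2)) {-1..0}"
      by (rule has_integral_eq_rhs[OF has_integral_eq[rotated]]) (auto simp: hat_def)
    have "((\<lambda>t::real. 1 - t) has_integral ((1 - 1\<^sup>2/2) - (0 - 0\<^sup>2/2))) {0..1}"
      by (rule fundamental_theorem_of_calculus)
         (auto intro!: derivative_eq_intros simp flip: has_real_derivative_iff_has_vector_derivative)
    then show "(hat has_integral (1/2)) {0..1}"
      by (rule has_integral_eq_rhs[OF has_integral_eq[rotated]]) (auto simp: hat_def)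
  qed auto
  have h2: "((\<lambda>t. (hat t)\<^sup>2) has_integral (1/3 + 1/3)) {-1..1}"
  proof (rule has_integral_combine[of "-1" 0 1])
    have "((\<lambda>t::real. (1 + t)\<^sup>2) has_integral ((1 + 0)^3/3 - (1 + (-1))^3/3)) {-1..0}"
      by (rule fundamental_theorem_of_calculus)
         (auto intro!: derivative_eq_intros simp flip: has_real_derivative_iff_has_vector_derivative)
    then show "((\<lambda>t. (hat t)\<^sup>2) has_integral (1/3)) {-1..0}"
      by (rule has_integral_eq_rhs[OF has_integral_eq[rotated]]) (auto simp: hat_def)
    have "((\<lambda>t::real. (1 - t)\<^sup>2) has_integral (-((1 - 1)^3)/3 - (-((1 - 0)^3)/3))) {0..1}"
      by (rule fundamental_theorem_of_calculus)
         (auto intro!: derivative_eq_intros simp flip: has_real_derivative_iff_has_vector_derivative)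
    then show "((\<lambda>t. (hat t)\<^sup>2) has_integral (1/3)) {0..1}"
      by (rule has_integral_eq_rhs[OF has_integral_eq[rotated]]) (auto simp: hat_def)
  qed auto
  have "(LINT t|lborel. hat t) = (LINT t:{-1..1}|lborel. hat t)"
    unfolding set_lebesgue_integral_def by (subst hat_indicator) (rule refl)
  also have "\<dots> = integral {-1..1} hat"
    by (rule set_borel_integral_eq_integral(2)) (unfold set_integrable_def, fold hat_indicator, rule i1)
  finally have "(LINT t|lborel. hat t) = integral {-1..1} hat" .
  then show "(LINT t|lborel. hat t) = 1"
    using h by (simp add: integral_unique)
  have "(LINT t|lborel. (hat t)\<^sup>2) = (LINT t:{-1..1}|lborel. (hat t)\<^sup>2)"
    unfolding set_lebesgue_integral_def by (subst hat2_indicator) (rule refl)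
  also have "\<dots> = integral {-1..1} (\<lambda>t. (hat t)\<^sup>2)"
    by (rule set_borel_integral_eq_integral(2))
       (unfold set_integrable_def, fold hat2_indicator, rule i2)
  finally have "(LINT t|lborel. (hat t)\<^sup>2) = integral {-1..1} (\<lambda>t. (hat t)\<^sup>2)" .
  then show "(LINT t|lborel. (hat t)\<^sup>2) = 2 / 3"
    using h2 by (simp add: integral_unique)
qed

lemma wave_integrable_integral:
  "integrable lborel wave" "(LINT t|lborel. wave t) = 0"
  "integrable lborel (\<lambda>t. (wave t)\<^sup>2)" "(LINT t|lborel. (wave t)\<^sup>2) = 2"
proof -
  have sq: "(\<lambda>t. (wave t)\<^sup>2) = indicator {-1..<1}"
    by (auto simp: fun_eq_iff wave_def indicator_def)
  show "integrable lborel wave" "(LINT t|lborel. wave t) = 0"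
    unfolding wave_def[abs_def] by auto
  show "integrable lborel (\<lambda>t. (wave t)\<^sup>2)" "(LINT t|lborel. (wave t)\<^sup>2) = 2"
    unfolding sq by auto
qed

lemma rescale_integrable_integral:
  fixes f :: "real \<Rightarrow> real"
  assumes "integrable lborel f"
  shows "integrable lborel (\<lambda>t. f (2 ^ k * t - c))"
    and "(LINT t|lborel. f (2 ^ k * t - c)) = (LINT t|lborel. f t) / 2 ^ k"
  using lborel_integrable_real_affine[OF assms, of "2 ^ k" "-c"]
        lborel_integral_real_affine[of "2 ^ k" f "-c"]
  by (simp_all add: field_simps)

lemma faber_integrable_integral:
  "integrable lborel (faber n)" "(LINT t|lborel. faber n t) = 1 / 2 ^ faber_level n"
  "(LINT t|lborel. faber n t * faber n t) = 2 / 3 / 2 ^ faber_level n"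
  using rescale_integrable_integral[OF hat_integrable_integral(1)]
        rescale_integrable_integral[OF hat_integrable_integral(3)]
  by (simp_all add: faber_eq_hat[abs_def] hat_integrable_integral flip: power2_eq_square)

lemma faber_deriv_integrable_integral:
  "integrable lborel (faber_deriv n)" "(LINT t|lborel. faber_deriv n t) = 0"
  "(LINT t|lborel. faber_deriv n t * faber_deriv n t) = 2 * 2 ^ faber_level n"
proof -
  show "integrable lborel (faber_deriv n)" "(LINT t|lborel. faber_deriv n t) = 0"
    using rescale_integrable_integral[OF wave_integrable_integral(1)]
    by (simp_all add: faber_deriv_def[abs_def] wave_integrable_integral)
  have "faber_deriv n t * faber_deriv n t =
      (2 ^ faber_level n)\<^sup>2 * (wave (2 ^ faber_level n * t - faber_centre n))\<^sup>2" for t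
    by (simp add: faber_deriv_def power2_eq_square)
  then show "(LINT t|lborel. faber_deriv n t * faber_deriv n t) = 2 * 2 ^ faber_level n"
    using rescale_integrable_integral(2)[OF wave_integrable_integral(3)]
    by (simp add: wave_integrable_integral(4)) (simp add: power2_eq_square)
qed

lemma faber_measurable [measurable]: "faber n \<in> borel_measurable borel"
  "faber_deriv n \<in> borel_measurable borel"
  using faber_integrable_integral(1) faber_deriv_integrable_integral(1)
  by (auto dest: borel_measurable_integrable)

lemma faber_mult_integrable:
  "integrable lborel (\<lambda>t. faber m t * faber n t)"
  "integrable lborel (\<lambda>t. faber_deriv m t * faber_deriv n t)"
proof -
  have "\<bar>faber m t * faber n t\<bar> \<le> \<bar>faber n t\<bar>" for t
    by (auto simp: faber_eq_hat hat_def abs_mult intro!: mult_left_le_one_le)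
  then show "integrable lborel (\<lambda>t. faber m t * faber n t)"
    by (intro Bochner_Integration.integrable_bound[OF faber_integrable_integral(1)[of n]]) auto
  have "\<bar>wave t\<bar> \<le> 1" for t
    by (auto simp: wave_def indicator_def)
  then have "\<bar>faber_deriv m t * faber_deriv n t\<bar> \<le> \<bar>2 ^ faber_level m * faber_deriv n t\<bar>" for t
    by (auto simp: faber_deriv_def abs_mult intro!: mult_left_le_one_le)
  then show "integrable lborel (\<lambda>t. faber_deriv m t * faber_deriv n t)"
    by (intro Bochner_Integration.integrable_bound[
          OF integrable_mult_right[OF faber_deriv_integrable_integral(1)[of n], of "2 ^ faber_level m"]]) auto
qed

section \<open>Orthogonality within a level and across levels\<close>

text \<open>Centres on one level are distinct odd numbers, hence at least 2 apart, so the two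
  supports meet at most in an endpoint. The half-open pieces of \<open>wave\<close> settle that
  endpoint for the derivatives.\<close>

lemma same_level_disjoint:
  assumes "m \<noteq> n" "faber_level m = faber_level n" "m \<ge> 1" "n \<ge> 1"
  shows "faber m t * faber n t = 0" "faber_deriv m t * faber_deriv n t = 0"
proof -
  \<comment> \<open>The lower bounds on \<open>m\<close> and \<open>n\<close> make the truncated
    subtraction in \<open>faber_centre\<close> exact, so distinct indices get distinct
    centres.\<close>
  have "floor_log m = floor_log n" "2 ^ floor_log m \<le> m" "2 ^ floor_log n \<le> n"
    using assms floor_log_exp2_le[of m] floor_log_exp2_le[of n] by (auto simp: faber_level_def)
  then have "faber_centre m + 2 \<le> faber_centre n \<or> faber_centre n + 2 \<le> faber_centre m"
    using assms(1) unfolding faber_centre_def by auto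
  then have *: "real (faber_centre m) + 2 \<le> faber_centre n \<or> real (faber_centre n) + 2 \<le> faber_centre m"
    by linarith
  then show "faber m t * faber n t = 0"
    unfolding faber_eq_hat assms(2) hat_def by auto
  from * show "faber_deriv m t * faber_deriv n t = 0"
    unfolding faber_deriv_def assms(2) wave_def indicator_def by auto
qed

lemma wave_floor: "wave t = (if \<lfloor>t\<rfloor> = -1 then 1 else if \<lfloor>t\<rfloor> = 0 then -1 else 0)"
  by (auto simp: wave_def indicator_def floor_eq_iff)

text \<open>The coarser derivative is constant wherever the finer one is nonzero, and the finer one
  has mean zero.\<close>

lemma faber_deriv_orthogonal:
  assumes "faber_level m < faber_level n"
  shows "(LINT t|lborel. faber_deriv m t * faber_deriv n t) = 0"
proof -
  define k where "k = faber_level m"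
  define r where "r = faber_level n - Suc k"
  have l: "faber_level n = Suc (k + r)" using assms by (simp add: k_def r_def)
  \<comment> \<open>\<open>j\<close> is the position of \<open>n\<close> within its level. Where
    \<open>faber_deriv n\<close> is nonzero, \<open>2 ^ (k + r) * t\<close> has floor
    \<open>j\<close>, so \<open>2 ^ k * t\<close> has floor \<open>j div 2 ^ r\<close>; hence
    \<open>c\<close> is the value of \<open>faber_deriv m\<close> there.\<close>
  define j where "j = n - 2 ^ floor_log n"
  define c where "c = 2 ^ k * (if int j div 2 ^ r - faber_centre m = -1 then 1
      else if int j div 2 ^ r - faber_centre m = 0 then -1 else 0::real)"
  have "faber_deriv m t * faber_deriv n t = c * faber_deriv n t" for t
  proof (cases "faber_deriv n t = 0")
    case False
    then have "-1 \<le> 2 * 2 ^ (k + r) * t - faber_centre n" "2 * 2 ^ (k + r) * t - faber_centre n < 1"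
      unfolding faber_deriv_def wave_def l by (auto simp: indicator_eq_0_iff split: split_indicator_asm)
    then have "\<lfloor>2 ^ (k + r) * t\<rfloor> = int j"
      by (auto simp: floor_eq_iff faber_centre_def j_def)
    moreover have "2 ^ k * t = 2 ^ (k + r) * t / real_of_int (2 ^ r)"
      by (simp add: power_add)
    ultimately have "\<lfloor>2 ^ k * t\<rfloor> = int j div 2 ^ r"
      using floor_divide_real_eq_div[of "2 ^ r" "2 ^ (k + r) * t"] by simp
    then have "\<lfloor>2 ^ k * t - faber_centre m\<rfloor> = int j div 2 ^ r - faber_centre m"
      by (simp only: floor_diff_of_int[of _ "int (faber_centre m)", simplified])
    then have "faber_deriv m t = c"
      by (simp add: faber_deriv_def wave_floor c_def flip: k_def)
    then show ?thesis by simp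
  qed simp
  then have "(LINT t|lborel. faber_deriv m t * faber_deriv n t) = c * (LINT t|lborel. faber_deriv n t)"
    by (simp only: integral_mult_right_zero)
  then show ?thesis
    by (simp add: faber_deriv_integrable_integral)
qed

text \<open>The derivatives are Haar functions, so in the derivative direction levels decouple, whereas the
  functions themselves are not orthogonal across levels.\<close>

lemma faber_deriv_inner_eq:
  assumes "m \<ge> 1" "n \<ge> 1"
  shows "(LINT t|lborel. faber_deriv m t * faber_deriv n t) =
    (if faber_level m = faber_level n then 3 * 4 ^ faber_level n else 0)
      * (LINT t|lborel. faber m t * faber n t)"
proof -
  consider "m = n" | "m \<noteq> n" "faber_level m = faber_level n"
    | "faber_level m < faber_level n" | "faber_level n < faber_level m"
    by linarith
  then show ?thesis
  proof cases
    case 1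
    \<comment> \<open>On level \<open>k\<close> the factor \<open>3 * 4 ^ k\<close> is the ratio of
      the two squared norms, \<open>2 * 2 ^ k\<close> and \<open>2 / 3 / 2 ^ k\<close>.\<close>
    have "(4::real) ^ faber_level n = 2 ^ faber_level n * 2 ^ faber_level n"
      by (simp flip: power_mult_distrib)
    with 1 show ?thesis
      by (simp add: faber_integrable_integral faber_deriv_integrable_integral)
  next
    case 2
    then have "faber m t * faber n t = 0" "faber_deriv m t * faber_deriv n t = 0" for t
      using same_level_disjoint[of m n] assms by blast+
    then show ?thesis by (simp only: integral_zero mult_zero_right)
  next
    case 3
    then show ?thesis using faber_deriv_orthogonal by simp
  next
    case 4
    then show ?thesis using faber_deriv_orthogonal[of n m] by (simp add: mult.commute)
  qed
qed

section \<open>Supports and pointwise derivatives\<close>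

text \<open>This is what lets all integrals run over the whole line, and later the whole space,
  instead of the unit cube.\<close>

lemma faber_eq_0_outside:
  assumes "n \<ge> 1" "t \<notin> {0..1}"
  shows "faber n t = 0" "faber_deriv n t = 0"
proof -
  have "n < 2 * 2 ^ floor_log n" using floor_log_exp2_gt[of n] assms by simp
  \<comment> \<open>The last centre of a level is \<open>2 ^ faber_level n - 1\<close>, so the right
    end of the support is at most 1.\<close>
  then have "faber_centre n + 1 \<le> 2 ^ faber_level n"
    by (simp add: faber_level_def faber_centre_def)
  then have c: "real (faber_centre n) + 1 \<le> 2 ^ faber_level n"
    using of_nat_mono[of "faber_centre n + 1" "2 ^ faber_level n", where 'a = real] by simp
  have c0: "real (faber_centre n) \<ge> 1"
    by (simp add: faber_centre_def)
  have "2 ^ faber_level n * t < 0 \<or> 2 ^ faber_level n < 2 ^ faber_level n * t"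
    using assms(2) by (auto simp: mult_less_0_iff)
  then have "2 ^ faber_level n * t - faber_centre n < -1 \<or> 1 < 2 ^ faber_level n * t - faber_centre n"
    using c c0 by linarith
  then show "faber n t = 0" "faber_deriv n t = 0"
    by (auto simp: faber_eq_hat faber_deriv_def hat_def wave_def indicator_def)
qed

definition faber_kinks :: "nat \<Rightarrow> real set" where
  "faber_kinks n = {t. 2 ^ faber_level n * t - faber_centre n \<in> {-1, 0, 1}}"

lemma finite_faber_kinks: "finite (faber_kinks n)"
proof -
  have "faber_kinks n \<subseteq> (\<lambda>y. (y + faber_centre n) / 2 ^ faber_level n) ` {-1, 0, 1}"
    by (auto simp: faber_kinks_def image_iff field_simps)
  then show ?thesis by (rule finite_subset) simp
qed

lemma hat_has_derivative:
  assumes "t \<notin> {-1, 0, 1}"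
  shows "(hat has_real_derivative wave t) (at t)"
proof -
  consider "t < -1" | "t \<in> {-1<..<0}" | "t \<in> {0<..<1}" | "t > 1" using assms by fastforce
  then show ?thesis
  proof cases
    case 1
    have "((\<lambda>t. 0) has_real_derivative wave t) (at t)"
      using 1 by (auto simp: wave_def)
    then show ?thesis
      by (rule has_field_derivative_transform_within_open[of _ _ _ "{..<-1}"]) (use 1 in \<open>auto simp: hat_def\<close>)
  next
    case 2
    have "((\<lambda>t. 1 + t) has_real_derivative wave t) (at t)"
      using 2 by (auto simp: wave_def intro!: derivative_eq_intros)
    then show ?thesis
      by (rule has_field_derivative_transform_within_open[of _ _ _ "{-1<..<0}"]) (use 2 in \<open>auto simp: hat_def\<close>)
  next
    case 3
    have "((\<lambda>t. 1 - t) has_real_derivative wave t) (at t)"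
      using 3 by (auto simp: wave_def intro!: derivative_eq_intros)
    then show ?thesis
      by (rule has_field_derivative_transform_within_open[of _ _ _ "{0<..<1}"]) (use 3 in \<open>auto simp: hat_def\<close>)
  next
    case 4
    have "((\<lambda>t. 0) has_real_derivative wave t) (at t)"
      using 4 by (auto simp: wave_def)
    then show ?thesis
      by (rule has_field_derivative_transform_within_open[of _ _ _ "{1<..}"]) (use 4 in \<open>auto simp: hat_def\<close>)
  qed
qed

lemma faber_has_derivative:
  assumes "t \<notin> faber_kinks n"
  shows "(faber n has_real_derivative faber_deriv n t) (at t)"
proof -
  have "((\<lambda>t. 2 ^ faber_level n * t - faber_centre n) has_real_derivative 2 ^ faber_level n) (at t)"
    by (auto intro!: derivative_eq_intros)
  from DERIV_chain2[OF hat_has_derivative this] assms show ?thesis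
    unfolding faber_eq_hat[abs_def] faber_deriv_def by (auto simp: faber_kinks_def mult.commute)
qed

section \<open>Tensor products and gradients\<close>

lemma bij_betw_axis_Basis: "bij_betw (\<lambda>i::'d::finite. axis i (1::real)) UNIV Basis"
  by (auto simp: bij_betw_def inj_on_def axis_eq_axis Basis_vec_def image_iff)

text \<open>Fubini for a pure tensor. \<open>lborel\<close> is the image of a product measure
  indexed by \<open>Basis\<close>, so the factors are first relabelled from coordinates to axis
  vectors.\<close>

lemma lborel_cart_prod:
  fixes f :: "'d::finite \<Rightarrow> real \<Rightarrow> real"
  assumes int: "\<And>i. integrable lborel (f i)"
  shows "integrable lborel (\<lambda>x::real ^ 'd. \<Prod>i\<in>UNIV. f i (x $ i))"
    and "(LINT x::real ^ 'd|lborel. (\<Prod>i\<in>UNIV. f i (x $ i))) = (\<Prod>i\<in>UNIV. LINT t|lborel. f i t)"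
proof -
  interpret product_sigma_finite "\<lambda>_::real ^ 'd. lborel :: real measure" ..
  define e where "e = (\<lambda>i::'d. axis i (1::real))"
  define g where "g b = f (inv e b)" for b
  note bij = bij_betw_axis_Basis[where 'd = 'd, folded e_def]
  have inv: "inv e (e i) = i" for i
    using bij by (intro inv_f_f) (simp add: bij_betw_def)
  have g_int: "integrable lborel (g b)" for b
    by (simp add: g_def int)
  then have [measurable]: "g b \<in> borel_measurable borel" for b
    by (auto dest: borel_measurable_integrable)
  have eq: "(\<Prod>i\<in>UNIV. f i (x $ i)) = (\<Prod>b\<in>Basis. g b (x \<bullet> b))" for x :: "real ^ 'd"
    by (subst prod.reindex_bij_betw[OF bij, symmetric])
       (simp add: g_def inv, simp add: e_def cart_eq_inner_axis)
  have eq_int: "(\<Prod>i\<in>UNIV. LINT t|lborel. f i t) = (\<Prod>b\<in>Basis. LINT t|lborel. g b t)"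
    by (subst prod.reindex_bij_betw[OF bij, symmetric]) (simp add: g_def inv)
  show "integrable lborel (\<lambda>x::real ^ 'd. \<Prod>i\<in>UNIV. f i (x $ i))"
    unfolding eq using product_integrable_prod[of Basis g] g_int
    by (subst lborel_eq) (simp add: integrable_distr_eq cong: prod.cong)
  show "(LINT x::real ^ 'd|lborel. (\<Prod>i\<in>UNIV. f i (x $ i))) = (\<Prod>i\<in>UNIV. LINT t|lborel. f i t)"
    unfolding eq eq_int using product_integral_prod[of Basis g] g_int
    by (subst lborel_eq) (simp add: integral_distr cong: prod.cong)
qed

text \<open>The \<open>i\<close>-th partial derivative of \<open>tensor_faber \<alpha>\<close>,
  given by a formula at every point; it agrees with the true derivative off the kinks, see
  \<open>tensor_faber_GDERIV\<close>.\<close>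

definition tensor_deriv :: "'d \<Rightarrow> ('d::finite \<Rightarrow> nat) \<Rightarrow> real ^ 'd \<Rightarrow> real" where
  "tensor_deriv i \<alpha> x = (\<Prod>j\<in>UNIV. (if j = i then faber_deriv (\<alpha> j) else faber (\<alpha> j)) (x $ j))"

text \<open>Carrying the coefficients \<open>a\<close> explicitly gives every element of a block a
  concrete derivative, \<open>block_deriv i \<beta> a\<close>.\<close>

definition block_comb :: "('d::finite \<Rightarrow> nat) \<Rightarrow> (('d \<Rightarrow> nat) \<Rightarrow> real) \<Rightarrow> real ^ 'd \<Rightarrow> real" where
  "block_comb \<beta> a x = (\<Sum>\<alpha>\<in>block_indices \<beta>. a \<alpha> * tensor_faber \<alpha> x)"

definition block_deriv ::
    "'d \<Rightarrow> ('d::finite \<Rightarrow> nat) \<Rightarrow> (('d \<Rightarrow> nat) \<Rightarrow> real) \<Rightarrow> real ^ 'd \<Rightarrow> real" where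
  "block_deriv i \<beta> a x = (\<Sum>\<alpha>\<in>block_indices \<beta>. a \<alpha> * tensor_deriv i \<alpha> x)"

lemma block_space_eq: "block_space \<beta> = range (block_comb \<beta>)"
  by (auto simp: block_space_def block_comb_def[abs_def])

lemma tensor_mult_integrable_integral:
  fixes \<alpha> \<alpha>' :: "'d::finite \<Rightarrow> nat"
  shows "integrable lborel (\<lambda>x. tensor_faber \<alpha> x * tensor_faber \<alpha>' x)"
    and "integrable lborel (\<lambda>x. tensor_deriv i \<alpha> x * tensor_deriv i \<alpha>' x)"
    and "(LINT x|lborel. tensor_faber \<alpha> x * tensor_faber \<alpha>' x) =
      (\<Prod>j\<in>UNIV. LINT t|lborel. faber (\<alpha> j) t * faber (\<alpha>' j) t)"
    and "(LINT x|lborel. tensor_deriv i \<alpha> x * tensor_deriv i \<alpha>' x) =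
      (LINT t|lborel. faber_deriv (\<alpha> i) t * faber_deriv (\<alpha>' i) t)
        * (\<Prod>j\<in>UNIV - {i}. LINT t|lborel. faber (\<alpha> j) t * faber (\<alpha>' j) t)"
proof -
  \<comment> \<open>Multiplying factor by factor gives a pure tensor again, so
    \<open>lborel_cart_prod\<close> applies.\<close>
  have eq: "tensor_deriv i \<alpha> x * tensor_deriv i \<alpha>' x =
      (\<Prod>j\<in>UNIV. (if j = i then \<lambda>t. faber_deriv (\<alpha> j) t * faber_deriv (\<alpha>' j) t
        else (\<lambda>t. faber (\<alpha> j) t * faber (\<alpha>' j) t)) (x $ j))" for x
    unfolding tensor_deriv_def by (auto simp flip: prod.distrib intro!: prod.cong)
  show "integrable lborel (\<lambda>x. tensor_faber \<alpha> x * tensor_faber \<alpha>' x)"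
    "(LINT x|lborel. tensor_faber \<alpha> x * tensor_faber \<alpha>' x) =
      (\<Prod>j\<in>UNIV. LINT t|lborel. faber (\<alpha> j) t * faber (\<alpha>' j) t)"
    unfolding tensor_faber_def prod.distrib[symmetric]
    by (rule lborel_cart_prod[where f = "\<lambda>j t. faber (\<alpha> j) t * faber (\<alpha>' j) t"]; simp add: faber_mult_integrable)+
  show "integrable lborel (\<lambda>x. tensor_deriv i \<alpha> x * tensor_deriv i \<alpha>' x)"
    unfolding eq by (rule lborel_cart_prod) (simp add: faber_mult_integrable)
  show "(LINT x|lborel. tensor_deriv i \<alpha> x * tensor_deriv i \<alpha>' x) =
      (LINT t|lborel. faber_deriv (\<alpha> i) t * faber_deriv (\<alpha>' i) t)
        * (\<Prod>j\<in>UNIV - {i}. LINT t|lborel. faber (\<alpha> j) t * faber (\<alpha>' j) t)"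
    unfolding eq
    by (subst lborel_cart_prod(2), simp add: faber_mult_integrable, subst prod.remove[of UNIV i])
       (auto intro!: prod.cong)
qed

lemma block_indices_level:
  assumes "\<alpha> \<in> block_indices \<beta>" "\<beta> \<in> multi_indices"
  shows "1 \<le> \<alpha> i" "faber_level (\<alpha> i) = \<beta> i"
proof -
  have "\<alpha> i \<in> level_indices (\<beta> i)" "1 \<le> \<beta> i"
    using assms by (auto simp: block_indices_def multi_indices_def)
  then show "1 \<le> \<alpha> i" "faber_level (\<alpha> i) = \<beta> i"
    using level_indices_faber_level by (auto simp: level_indices_def intro: order_trans[of _ "2 ^ (\<beta> i - 1)"])
qed

lemma block_mult_integrable:
  "integrable lborel (\<lambda>x. block_comb \<beta> a x * block_comb \<beta>' a' x)"
  "integrable lborel (\<lambda>x. block_deriv i \<beta> a x * block_deriv i \<beta>' a' x)"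
proof -
  have "(a \<alpha> * u) * (a' \<alpha>' * v) = (a \<alpha> * a' \<alpha>') * (u * v)" for u v :: real and \<alpha> \<alpha>'
    by simp
  note eq = block_comb_def block_deriv_def sum_product this
  show "integrable lborel (\<lambda>x. block_comb \<beta> a x * block_comb \<beta>' a' x)"
    "integrable lborel (\<lambda>x. block_deriv i \<beta> a x * block_deriv i \<beta>' a' x)"
    unfolding eq
    by (intro Bochner_Integration.integrable_sum integrable_mult_right tensor_mult_integrable_integral)+
qed

text \<open>Only the \<open>i\<close>-th univariate factor changes, by
  \<open>faber_deriv_inner_eq\<close>. Its multiplier depends on the blocks and not on the
  individual \<open>\<alpha>\<close>, \<open>\<alpha>'\<close>, so it leaves the double sum.\<close>

lemma block_deriv_inner_eq:
  assumes "\<beta> \<in> multi_indices" "\<beta>' \<in> multi_indices"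
  shows "(LINT x|lborel. block_deriv i \<beta> a x * block_deriv i \<beta>' a' x) =
    (if \<beta> i = \<beta>' i then 3 * 4 ^ \<beta>' i else 0) * (LINT x|lborel. block_comb \<beta> a x * block_comb \<beta>' a' x)"
    (is "_ = ?w * _")
proof -
  have tensor: "(LINT x|lborel. tensor_deriv i \<alpha> x * tensor_deriv i \<alpha>' x) =
      ?w * (LINT x|lborel. tensor_faber \<alpha> x * tensor_faber \<alpha>' x)"
    if "\<alpha> \<in> block_indices \<beta>" "\<alpha>' \<in> block_indices \<beta>'" for \<alpha> \<alpha>'
  proof -
    have "(LINT t|lborel. faber_deriv (\<alpha> i) t * faber_deriv (\<alpha>' i) t) =
        ?w * (LINT t|lborel. faber (\<alpha> i) t * faber (\<alpha>' i) t)"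
      using faber_deriv_inner_eq[of "\<alpha> i" "\<alpha>' i"] block_indices_level[of \<alpha> \<beta> i]
        block_indices_level[of \<alpha>' \<beta>' i] that assms by simp
    then show ?thesis
      unfolding tensor_mult_integrable_integral by (simp add: prod.remove[of UNIV i])
  qed
  have e: "(a \<alpha> * u) * (a' \<alpha>' * v) = (a \<alpha> * a' \<alpha>') * (u * v)" for u v :: real and \<alpha> \<alpha>'
    by simp
  have "(LINT x|lborel. block_deriv i \<beta> a x * block_deriv i \<beta>' a' x) =
     (\<Sum>\<alpha>\<in>block_indices \<beta>. \<Sum>\<alpha>'\<in>block_indices \<beta>'. a \<alpha> * a' \<alpha>' *
        (LINT x|lborel. tensor_deriv i \<alpha> x * tensor_deriv i \<alpha>' x))"
    unfolding block_deriv_def sum_product e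
    by (subst Bochner_Integration.integral_sum
       | intro Bochner_Integration.integrable_sum integrable_mult_right tensor_mult_integrable_integral
       | simp)+
  also have "\<dots> = ?w * (\<Sum>\<alpha>\<in>block_indices \<beta>. \<Sum>\<alpha>'\<in>block_indices \<beta>'. a \<alpha> * a' \<alpha>' *
        (LINT x|lborel. tensor_faber \<alpha> x * tensor_faber \<alpha>' x))"
    unfolding sum_distrib_left by (intro sum.cong refl) (simp only: tensor ac_simps)
  also have "(\<Sum>\<alpha>\<in>block_indices \<beta>. \<Sum>\<alpha>'\<in>block_indices \<beta>'. a \<alpha> * a' \<alpha>' *
        (LINT x|lborel. tensor_faber \<alpha> x * tensor_faber \<alpha>' x)) =
      (LINT x|lborel. block_comb \<beta> a x * block_comb \<beta>' a' x)"
    unfolding block_comb_def sum_product e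
    by (subst Bochner_Integration.integral_sum
       | intro Bochner_Integration.integrable_sum integrable_mult_right tensor_mult_integrable_integral
       | simp)+
  finally show ?thesis .
qed

section \<open>From norms on the cube to integrals over the space\<close>

lemma block_eq_0_outside:
  assumes "\<beta> \<in> multi_indices" "x \<notin> unit_cube"
  shows "block_comb \<beta> a x = 0" "block_deriv i \<beta> a x = 0"
proof -
  obtain j where j: "x $ j \<notin> {0..1}"
    using assms(2) by (auto simp: unit_cube_def mem_box_cart)
  have "tensor_faber \<alpha> x = 0" "tensor_deriv i \<alpha> x = 0" if "\<alpha> \<in> block_indices \<beta>" for \<alpha>
    using faber_eq_0_outside[OF block_indices_level(1)[OF that assms(1)] j]
    unfolding tensor_faber_def tensor_deriv_def by (intro prod_zero bexI[of _ j]; force)+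
  then show "block_comb \<beta> a x = 0" "block_deriv i \<beta> a x = 0"
    by (simp_all add: block_comb_def block_deriv_def)
qed

lemma block_measurable [measurable]:
  fixes \<beta> :: "'d::finite \<Rightarrow> nat"
  shows "block_comb \<beta> a \<in> borel_measurable borel" "block_deriv i \<beta> a \<in> borel_measurable borel"
proof -
  have [measurable]: "(\<lambda>x::real ^ 'd. x $ j) \<in> borel_measurable borel" for j :: 'd
    by (intro borel_measurable_continuous_onI continuous_intros)
  have "(\<lambda>x. (if j = i then faber_deriv n else faber n) (x $ j)) \<in> borel_measurable borel"
    for i j :: 'd and n
    by simp
  then show "block_comb \<beta> a \<in> borel_measurable borel" "block_deriv i \<beta> a \<in> borel_measurable borel"
    unfolding block_comb_def[abs_def] block_deriv_def[abs_def] tensor_faber_def tensor_deriv_def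
    by measurable
qed

text \<open>Vanishing outside the cube removes the indicator, and Borel measurability permits
  passing from the completed measure to \<open>lborel\<close>.\<close>

lemma LINT_cube_eq:
  fixes f :: "real ^ 'd::finite \<Rightarrow> real"
  assumes "f \<in> borel_measurable borel" "\<And>x. x \<notin> unit_cube \<Longrightarrow> f x = 0"
  shows "(LINT x:unit_cube|lebesgue. f x) = (LINT x|lborel. f x)"
proof -
  have "indicator unit_cube x *\<^sub>R f x = f x" for x
    using assms(2) by (auto simp: indicator_def)
  then show ?thesis
    unfolding set_lebesgue_integral_def using assms(1) by (simp only: integral_completion measurable_lborel2)
qed

lemma L2_norm_block_comb:
  assumes "\<beta> \<in> multi_indices"
  shows "(L2_norm (block_comb \<beta> a))\<^sup>2 = (LINT x|lborel. block_comb \<beta> a x * block_comb \<beta> a x)"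
proof -
  have "(LINT x:unit_cube|lebesgue. (block_comb \<beta> a x)\<^sup>2) =
      (LINT x|lborel. block_comb \<beta> a x * block_comb \<beta> a x)"
    unfolding power2_eq_square by (rule LINT_cube_eq) (simp_all add: block_eq_0_outside assms)
  then show ?thesis
    unfolding L2_norm_def by (simp add: integral_nonneg_AE)
qed

section \<open>Gradients almost everywhere\<close>

lemma tensor_faber_GDERIV:
  assumes "\<And>i. x $ i \<notin> faber_kinks (\<alpha> i)"
  shows "GDERIV (tensor_faber \<alpha>) x :> (\<chi> i. tensor_deriv i \<alpha> x)"
proof -
  have "((\<lambda>x. faber (\<alpha> i) (x $ i)) has_derivative (\<lambda>y. faber_deriv (\<alpha> i) (x $ i) * (y $ i))) (at x)" for i
  proof -
    have "((\<lambda>x. x $ i) has_derivative (\<lambda>y. y $ i)) (at x)"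
      by (rule bounded_linear_imp_has_derivative[OF bounded_linear_vec_nth])
    then show ?thesis
      using faber_has_derivative[OF assms] unfolding has_field_derivative_def
      by (rule has_derivative_compose)
  qed
  then have "(tensor_faber \<alpha> has_derivative
      (\<lambda>y. \<Sum>i\<in>UNIV. faber_deriv (\<alpha> i) (x $ i) * (y $ i) * (\<Prod>j\<in>UNIV - {i}. faber (\<alpha> j) (x $ j)))) (at x)"
    unfolding tensor_faber_def[abs_def] by (rule has_derivative_prod)
  moreover have "tensor_deriv i \<alpha> x =
      faber_deriv (\<alpha> i) (x $ i) * (\<Prod>j\<in>UNIV - {i}. faber (\<alpha> j) (x $ j))" for i
    unfolding tensor_deriv_def by (subst prod.remove[of UNIV i]) (auto intro!: prod.cong)
  ultimately show ?thesis
    unfolding gderiv_def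
    by (elim has_derivative_eq_rhs) (simp add: fun_eq_iff inner_vec_def ac_simps)
qed

text \<open>The assumption avoids the kinks of all \<open>n\<close> at once, so one exceptional set
  serves every index set and every choice of coefficients.\<close>

lemma block_comb_sum_gradient:
  assumes "finite \<Lambda>" "\<And>i n. x $ i \<notin> faber_kinks n"
  shows "gradient (\<lambda>x. \<Sum>\<beta>\<in>\<Lambda>. block_comb \<beta> (a \<beta>) x) x = (\<chi> i. \<Sum>\<beta>\<in>\<Lambda>. block_deriv i \<beta> (a \<beta>) x)"
    (is "gradient ?u x = ?g")
proof -
  have "(?u has_derivative (\<lambda>y. \<Sum>\<beta>\<in>\<Lambda>. \<Sum>\<alpha>\<in>block_indices \<beta>. a \<beta> \<alpha> * (y \<bullet> (\<chi> i. tensor_deriv i \<alpha> x)))) (at x)"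
    unfolding block_comb_def
    by (intro has_derivative_sum has_derivative_mult_right
        tensor_faber_GDERIV[unfolded gderiv_def] assms(2))
  moreover have "(\<Sum>\<beta>\<in>\<Lambda>. \<Sum>\<alpha>\<in>block_indices \<beta>. a \<beta> \<alpha> * (y \<bullet> (\<chi> i. tensor_deriv i \<alpha> x))) = y \<bullet> ?g" for y
  proof -
    have "?g = (\<Sum>\<beta>\<in>\<Lambda>. \<Sum>\<alpha>\<in>block_indices \<beta>. a \<beta> \<alpha> *\<^sub>R (\<chi> i. tensor_deriv i \<alpha> x))"
      by (simp add: vec_eq_iff block_deriv_def)
    then show ?thesis
      by (simp add: inner_sum_right)
  qed
  ultimately have g: "GDERIV ?u x :> ?g"
    unfolding gderiv_def by (simp only:)
  show ?thesis
    unfolding gradient_def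
  \<comment> \<open>\<open>gradient\<close> is a definite description, so uniqueness is required
    too: the derivative at a point is unique, and inner products determine a vector.\<close>
  proof (rule the_equality, rule g)
    fix g assume "GDERIV ?u x :> g"
    with g have "(\<lambda>h. h \<bullet> g) = (\<lambda>h. h \<bullet> ?g)"
      unfolding gderiv_def by (rule has_derivative_unique[rotated])
    then show "g = ?g"
      by (simp only: fun_eq_iff vector_eq_ldot)
  qed
qed

text \<open>Each \<open>faber_kinks n\<close> is finite, so the exceptional set is a countable union
  of coordinate hyperplanes.\<close>

lemma AE_not_faber_kink: "AE x in lebesgue. \<forall>(i::'d::finite) n. (x :: real ^ 'd) $ i \<notin> faber_kinks n"
proof -
  have UN: "negligible (\<Union>x\<in>A. f x)" if "countable A" "\<And>x. x \<in> A \<Longrightarrow> negligible (f x)"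
    for A :: "'c set" and f :: "'c \<Rightarrow> (real ^ 'd) set"
    by (rule negligible_countable_Union) (use that in auto)
  have "negligible (\<Union>i::'d. \<Union>n. \<Union>c\<in>faber_kinks n. {x :: real ^ 'd. x \<bullet> axis i 1 = c})"
    by (intro UN) (auto simp: countable_finite finite_faber_kinks)
  then show ?thesis
    unfolding negligible_iff_null_sets
    by (rule AE_I') (auto simp: cart_eq_inner_axis)
qed

section \<open>Splitting the energy norm by direction and level\<close>

lemma H10_norm_block_sum:
  fixes \<Lambda> :: "('d::finite \<Rightarrow> nat) set"
  assumes "finite \<Lambda>" "\<Lambda> \<subseteq> multi_indices"
  shows "(H10_norm (\<lambda>x. \<Sum>\<beta>\<in>\<Lambda>. block_comb \<beta> (a \<beta>) x))\<^sup>2 =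
    (\<Sum>i\<in>UNIV. LINT x|lborel. (\<Sum>\<beta>\<in>\<Lambda>. block_deriv i \<beta> (a \<beta>) x)\<^sup>2)"
proof -
  let ?u = "\<lambda>x. \<Sum>\<beta>\<in>\<Lambda>. block_comb \<beta> (a \<beta>) x"
  let ?p = "\<lambda>x. \<Sum>i\<in>UNIV. (\<Sum>\<beta>\<in>\<Lambda>. block_deriv i \<beta> (a \<beta>) x)\<^sup>2"
  have "AE x in lebesgue. ?p x = (norm (gradient ?u x))\<^sup>2"
    using AE_not_faber_kink
  proof eventually_elim
    case (elim x)
    then have "gradient ?u x = (\<chi> i. \<Sum>\<beta>\<in>\<Lambda>. block_deriv i \<beta> (a \<beta>) x)"
      by (intro block_comb_sum_gradient assms(1)) auto
    then show ?case
      by (simp add: power2_norm_eq_inner inner_vec_def) (simp add: power2_eq_square)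
  qed
  then have AE: "AE x in lebesgue. indicator unit_cube x *\<^sub>R ?p x =
      indicator unit_cube x *\<^sub>R (norm (gradient ?u x))\<^sup>2"
    by eventually_elim simp
  \<comment> \<open>The explicit integrand is measurable, and since \<open>lebesgue\<close> is
    complete, so is the almost everywhere equal one built from \<open>gradient\<close>, whatever its
    values at kinks.\<close>
  have meas: "(\<lambda>x. indicator unit_cube x *\<^sub>R ?p x) \<in> borel_measurable lebesgue"
    by (intro measurable_completion) (simp add: unit_cube_def)
  have "(LINT x:unit_cube|lebesgue. (norm (gradient ?u x))\<^sup>2) = (LINT x:unit_cube|lebesgue. ?p x)"
    unfolding set_lebesgue_integral_def
    by (rule integral_cong_AE[OF meas borel_measurable_AE[OF meas AE] AE, symmetric])
  also have "\<dots> = (LINT x|lborel. ?p x)"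
    by (rule LINT_cube_eq) (use assms(2) in \<open>auto intro!: sum.neutral simp: block_eq_0_outside subset_iff\<close>)
  also have "\<dots> = (\<Sum>i\<in>UNIV. LINT x|lborel. (\<Sum>\<beta>\<in>\<Lambda>. block_deriv i \<beta> (a \<beta>) x)\<^sup>2)"
    by (rule Bochner_Integration.integral_sum)
       (auto simp: power2_eq_square sum_product intro!: Bochner_Integration.integrable_sum block_mult_integrable)
  finally show ?thesis
    unfolding H10_norm_def by (simp add: sum_nonneg integral_nonneg_AE)
qed

text \<open>Expand the square: inner products of derivatives survive only for
  \<open>\<beta> i = \<beta>' i\<close>. Grouping by this common value makes the factor constant,
  and each remaining double sum is again the square of a partial sum.\<close>

lemma block_deriv_sum_norm:
  fixes \<Lambda> :: "('d::finite \<Rightarrow> nat) set"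
  assumes "finite \<Lambda>" "\<Lambda> \<subseteq> multi_indices"
  shows "(LINT x|lborel. (\<Sum>\<beta>\<in>\<Lambda>. block_deriv i \<beta> (a \<beta>) x)\<^sup>2) =
    (\<Sum>k\<in>(\<lambda>\<beta>. \<beta> i) ` \<Lambda>. 3 * 4 ^ k * (LINT x|lborel. (\<Sum>\<beta>\<in>{\<beta>\<in>\<Lambda>. \<beta> i = k}. block_comb \<beta> (a \<beta>) x)\<^sup>2))"
proof -
  let ?ip = "\<lambda>\<beta> \<beta>'. LINT x|lborel. block_comb \<beta> (a \<beta>) x * block_comb \<beta>' (a \<beta>') x"
  have "(LINT x|lborel. (\<Sum>\<beta>\<in>\<Lambda>. block_deriv i \<beta> (a \<beta>) x)\<^sup>2) =
      (\<Sum>\<beta>\<in>\<Lambda>. \<Sum>\<beta>'\<in>\<Lambda>. LINT x|lborel. block_deriv i \<beta> (a \<beta>) x * block_deriv i \<beta>' (a \<beta>') x)"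
    unfolding power2_eq_square sum_product
    by (subst Bochner_Integration.integral_sum
       | intro Bochner_Integration.integrable_sum block_mult_integrable | simp)+
  also have "\<dots> = (\<Sum>\<beta>\<in>\<Lambda>. \<Sum>\<beta>'\<in>\<Lambda>. (if \<beta> i = \<beta>' i then 3 * 4 ^ \<beta>' i else 0) * ?ip \<beta> \<beta>')"
    using assms(2) by (intro sum.cong refl block_deriv_inner_eq) auto
  also have "\<dots> = (\<Sum>\<beta>\<in>\<Lambda>. \<Sum>\<beta>'\<in>{\<beta>'\<in>\<Lambda>. \<beta>' i = \<beta> i}. 3 * 4 ^ \<beta> i * ?ip \<beta> \<beta>')"
    using assms(1) by (subst sum.inter_filter) (auto intro!: sum.cong)
  also have "\<dots> = (\<Sum>k\<in>(\<lambda>\<beta>. \<beta> i) ` \<Lambda>. \<Sum>\<beta>\<in>{\<beta>\<in>\<Lambda>. \<beta> i = k}. \<Sum>\<beta>'\<in>{\<beta>'\<in>\<Lambda>. \<beta>' i = \<beta> i}. 3 * 4 ^ \<beta> i * ?ip \<beta> \<beta>')"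
    by (rule sum.image_gen[OF assms(1)])
  also have "\<dots> = (\<Sum>k\<in>(\<lambda>\<beta>. \<beta> i) ` \<Lambda>. 3 * 4 ^ k * (LINT x|lborel. (\<Sum>\<beta>\<in>{\<beta>\<in>\<Lambda>. \<beta> i = k}. block_comb \<beta> (a \<beta>) x)\<^sup>2))"
  proof (intro sum.cong refl)
    fix k
    have "(LINT x|lborel. (\<Sum>\<beta>\<in>{\<beta>\<in>\<Lambda>. \<beta> i = k}. block_comb \<beta> (a \<beta>) x)\<^sup>2) =
       (\<Sum>\<beta>\<in>{\<beta>\<in>\<Lambda>. \<beta> i = k}. \<Sum>\<beta>'\<in>{\<beta>'\<in>\<Lambda>. \<beta>' i = k}. ?ip \<beta> \<beta>')"
      unfolding power2_eq_square sum_product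
      by (subst Bochner_Integration.integral_sum
         | intro Bochner_Integration.integrable_sum block_mult_integrable | simp)+
    then show "(\<Sum>\<beta>\<in>{\<beta>\<in>\<Lambda>. \<beta> i = k}. \<Sum>\<beta>'\<in>{\<beta>'\<in>\<Lambda>. \<beta>' i = \<beta> i}. 3 * 4 ^ \<beta> i * ?ip \<beta> \<beta>') =
       3 * 4 ^ k * (LINT x|lborel. (\<Sum>\<beta>\<in>{\<beta>\<in>\<Lambda>. \<beta> i = k}. block_comb \<beta> (a \<beta>) x)\<^sup>2)"
      by (simp add: sum_distrib_left)
  qed
  finally show ?thesis .
qed

section \<open>The stability constant\<close>

lemma block_comb_sum_L2_le:
  fixes M :: "('d::finite \<Rightarrow> nat) set" and w :: "('d \<Rightarrow> nat) \<Rightarrow> real"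
  assumes "\<And>\<beta>. 0 < w \<beta>"
  shows "(LINT x|lborel. (\<Sum>\<beta>\<in>M. block_comb \<beta> (a \<beta>) x)\<^sup>2) \<le>
    (\<Sum>\<beta>\<in>M. 1 / w \<beta>) * (\<Sum>\<beta>\<in>M. w \<beta> * (LINT x|lborel. block_comb \<beta> (a \<beta>) x * block_comb \<beta> (a \<beta>) x))"
proof -
  let ?f = "\<lambda>\<beta>. block_comb \<beta> (a \<beta>)"
  let ?rhs = "\<lambda>x. (\<Sum>\<beta>\<in>M. 1 / w \<beta>) * (\<Sum>\<beta>\<in>M. w \<beta> * (?f \<beta> x * ?f \<beta> x))"
  have "(\<Sum>\<beta>\<in>M. ?f \<beta> x)\<^sup>2 \<le> ?rhs x" for x
  proof -
    \<comment> \<open>Splitting each term as \<open>1 / sqrt w\<close> times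
      \<open>sqrt w * f\<close> brings the free weights into the pointwise inequality, which is then
      integrated.\<close>
    have "(\<Sum>\<beta>\<in>M. ?f \<beta> x)\<^sup>2 = (\<Sum>\<beta>\<in>M. (1 / sqrt (w \<beta>)) * (sqrt (w \<beta>) * ?f \<beta> x))\<^sup>2"
      using assms by (simp add: less_imp_neq[THEN not_sym])
    also have "\<dots> \<le> (\<Sum>\<beta>\<in>M. (1 / sqrt (w \<beta>))\<^sup>2) * (\<Sum>\<beta>\<in>M. (sqrt (w \<beta>) * ?f \<beta> x)\<^sup>2)"
      by (rule Cauchy_Schwarz_ineq_sum)
    also have "\<dots> = ?rhs x"
      using assms by (simp add: power_mult_distrib power_divide less_imp_le) (simp add: power2_eq_square)
    finally show ?thesis .
  qed
  then have "(LINT x|lborel. (\<Sum>\<beta>\<in>M. ?f \<beta> x)\<^sup>2) \<le> (LINT x|lborel. ?rhs x)"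
    by (intro integral_mono)
       (auto simp: power2_eq_square sum_product
         intro!: Bochner_Integration.integrable_sum block_mult_integrable integrable_mult_right)
  also have "\<dots> = (\<Sum>\<beta>\<in>M. 1 / w \<beta>) * (\<Sum>\<beta>\<in>M. w \<beta> * (LINT x|lborel. ?f \<beta> x * ?f \<beta> x))"
    by (subst integral_mult_right_zero, subst Bochner_Integration.integral_sum)
       (auto intro!: block_mult_integrable integrable_mult_right)
  finally show ?thesis .
qed

lemma max_index_ge: "\<beta> i \<le> max_index (\<beta> :: 'd::finite \<Rightarrow> nat)"
  by (simp add: max_index_def)

lemma max_index_attained: obtains i where "max_index (\<beta> :: 'd::finite \<Rightarrow> nat) = \<beta> i"
proof -
  have "Max (range \<beta>) \<in> range \<beta>" by (rule Max_in) auto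
  then show thesis using that unfolding max_index_def by blast
qed

lemma max_index_bounds:
  assumes "finite \<Lambda>" "\<Lambda> \<subseteq> multi_indices" "\<beta> \<in> \<Lambda>"
  shows "1 \<le> max_index (\<beta> :: 'd::finite \<Rightarrow> nat)" "max_index \<beta> \<le> top_level \<Lambda>"
proof -
  \<comment> \<open>\<open>undefined\<close> stands for an arbitrary coordinate.\<close>
  have "1 \<le> \<beta> undefined"
    using assms by (auto simp: multi_indices_def)
  then show "1 \<le> max_index \<beta>"
    using max_index_ge order_trans by blast
  show "max_index \<beta> \<le> top_level \<Lambda>"
    using assms by (simp add: top_level_def)
qed

text \<open>\<open>max_layer_card\<close> ranges only over \<open>1..top_level \<Lambda>\<close>,
  but all other layers are empty.\<close>

lemma card_index_layer_le:
  assumes "finite \<Lambda>" "\<Lambda> \<subseteq> multi_indices"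
  shows "card (index_layer \<Lambda> k) \<le> max_layer_card \<Lambda>"
proof (cases "index_layer \<Lambda> k = {}")
  case False
  then have "k \<in> {1..top_level \<Lambda>}"
    using max_index_bounds[OF assms] by (auto simp: index_layer_def)
  then show ?thesis
    unfolding max_layer_card_def by (intro Max_ge) auto
qed simp

lemma max_layer_attained:
  assumes "finite \<Lambda>" "\<Lambda> \<noteq> {}" "\<Lambda> \<subseteq> multi_indices"
  obtains k where "card (index_layer \<Lambda> k) = max_layer_card \<Lambda>" "max_layer_card \<Lambda> > 0"
proof -
  have "top_level \<Lambda> \<in> max_index ` \<Lambda>"
    unfolding top_level_def using assms by (intro Max_in) auto
  then obtain \<beta> where \<beta>: "\<beta> \<in> \<Lambda>" "\<beta> \<in> index_layer \<Lambda> (top_level \<Lambda>)" "1 \<le> top_level \<Lambda>"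
    using max_index_bounds(1)[OF assms(1,3)] by (auto simp: index_layer_def)
  moreover have "finite (index_layer \<Lambda> (top_level \<Lambda>))"
    using assms(1) by (simp add: index_layer_def)
  ultimately have "0 < card (index_layer \<Lambda> (top_level \<Lambda>))"
    by (auto simp: card_gt_0_iff)
  also have "\<dots> \<le> max_layer_card \<Lambda>"
    by (rule card_index_layer_le[OF assms(1,3)])
  finally have pos: "max_layer_card \<Lambda> > 0" .
  have "max_layer_card \<Lambda> \<in> (\<lambda>k. card (index_layer \<Lambda> k)) ` {1..top_level \<Lambda>}"
    unfolding max_layer_card_def using \<beta>(3) by (intro Max_in) auto
  then show thesis using pos that by auto
qed

text \<open>Indices with the same \<open>max_index\<close> lie in one layer, so each value of
  \<open>max_index \<beta> - k\<close> is taken at most \<open>max_layer_card \<Lambda>\<close>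
  times; the geometric series of ratio \<open>1 / 4\<close> sums to \<open>4 / 3\<close>.\<close>

lemma sum_layer_weights_le:
  fixes \<Lambda> :: "('d::finite \<Rightarrow> nat) set"
  assumes "finite \<Lambda>" "\<Lambda> \<subseteq> multi_indices"
  shows "(\<Sum>\<beta>\<in>{\<beta>\<in>\<Lambda>. \<beta> i = k}. 1 / 4 ^ (max_index \<beta> - k)) \<le> 4 / 3 * real (max_layer_card \<Lambda>)"
proof -
  define M where "M = {\<beta>\<in>\<Lambda>. \<beta> i = k}"
  define n where "n = real (max_layer_card \<Lambda>)"
  have fin: "finite M" using assms(1) by (simp add: M_def)
  have ge: "k \<le> max_index \<beta>" if "\<beta> \<in> M" for \<beta>
    using that max_index_ge[of \<beta> i] by (simp add: M_def)
  have "(\<Sum>\<beta>\<in>M. 1 / 4 ^ (max_index \<beta> - k)) =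
      (\<Sum>l\<in>max_index ` M. \<Sum>\<beta>\<in>{\<beta>\<in>M. max_index \<beta> = l}. 1 / 4 ^ (max_index \<beta> - k))"
    by (rule sum.image_gen[OF fin])
  also have "\<dots> \<le> (\<Sum>l\<in>max_index ` M. n * (1 / 4) ^ (l - k))"
  proof (rule sum_mono)
    fix l
    have "card {\<beta>\<in>M. max_index \<beta> = l} \<le> card (index_layer \<Lambda> l)"
      by (rule card_mono) (use assms(1) in \<open>auto simp: index_layer_def M_def\<close>)
    also have "\<dots> \<le> max_layer_card \<Lambda>"
      by (rule card_index_layer_le[OF assms])
    finally have "real (card {\<beta>\<in>M. max_index \<beta> = l}) * (1 / 4) ^ (l - k) \<le> n * (1 / 4) ^ (l - k)"
      unfolding n_def by (intro mult_right_mono) auto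
    then show "(\<Sum>\<beta>\<in>{\<beta>\<in>M. max_index \<beta> = l}. 1 / 4 ^ (max_index \<beta> - k)) \<le> n * (1 / 4) ^ (l - k)"
      by (simp add: power_one_over)
  qed
  also have "\<dots> = n * (\<Sum>j\<in>(\<lambda>l. l - k) ` max_index ` M. (1 / 4) ^ j)"
  proof -
    \<comment> \<open>All these \<open>l\<close> are at least \<open>k\<close>, so the truncated
      subtraction is injective and the exponents are distinct.\<close>
    have "inj_on (\<lambda>l. l - k) (max_index ` M)"
      using ge by (auto simp: inj_on_def dest!: eq_diff_iff[THEN iffD1, rotated 2])
    then show ?thesis by (simp add: sum.reindex sum_distrib_left)
  qed
  also have "\<dots> \<le> n * (\<Sum>j. (1 / 4) ^ j)"
    using fin by (intro mult_left_mono sum_le_suminf) (auto simp: n_def)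
  also have "\<dots> = 4 / 3 * n"
    by (simp add: suminf_geometric)
  finally show ?thesis by (simp add: M_def n_def)
qed

text \<open>Per direction the constant is 4: the 3 from differentiation times the
  \<open>4 / 3\<close> of the geometric series. There are \<open>CARD('d)\<close>
  directions.\<close>

lemma stability_constantI_upper:
  fixes \<Lambda> :: "('d::finite \<Rightarrow> nat) set"
  assumes "finite \<Lambda>" "\<Lambda> \<subseteq> multi_indices"
  shows "stability_constant \<Lambda> (4 * real CARD('d) * real (max_layer_card \<Lambda>))"
  unfolding stability_constant_def
proof (intro allI impI)
  fix s assume "\<forall>\<beta>\<in>\<Lambda>. s \<beta> \<in> block_space \<beta>"
  then have "\<forall>\<beta>\<in>\<Lambda>. \<exists>a. s \<beta> = block_comb \<beta> a"
    by (auto simp: block_space_eq)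
  then obtain a where s: "\<And>\<beta>. \<beta> \<in> \<Lambda> \<Longrightarrow> s \<beta> = block_comb \<beta> (a \<beta>)"
    by metis
  define n where "n = real (max_layer_card \<Lambda>)"
  define q where "q \<beta> = (LINT x|lborel. block_comb \<beta> (a \<beta>) x * block_comb \<beta> (a \<beta>) x)" for \<beta>
  have q0: "0 \<le> q \<beta>" for \<beta>
    by (simp add: q_def)
  have layer: "3 * 4 ^ k * (LINT x|lborel. (\<Sum>\<beta>\<in>{\<beta>\<in>\<Lambda>. \<beta> i = k}. block_comb \<beta> (a \<beta>) x)\<^sup>2)
      \<le> 4 * n * (\<Sum>\<beta>\<in>{\<beta>\<in>\<Lambda>. \<beta> i = k}. 4 ^ max_index \<beta> * q \<beta>)" for i k
  proof -
    let ?M = "{\<beta>\<in>\<Lambda>. \<beta> i = k}"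
    have "(LINT x|lborel. (\<Sum>\<beta>\<in>?M. block_comb \<beta> (a \<beta>) x)\<^sup>2) \<le>
        (\<Sum>\<beta>\<in>?M. 1 / 4 ^ (max_index \<beta> - k)) * (\<Sum>\<beta>\<in>?M. 4 ^ (max_index \<beta> - k) * q \<beta>)"
      unfolding q_def by (rule block_comb_sum_L2_le) simp
    also have "\<dots> \<le> (4 / 3 * n) * (\<Sum>\<beta>\<in>?M. 4 ^ (max_index \<beta> - k) * q \<beta>)"
      unfolding n_def by (intro mult_right_mono sum_layer_weights_le assms sum_nonneg) (simp add: q0)
    finally have "3 * 4 ^ k * (LINT x|lborel. (\<Sum>\<beta>\<in>?M. block_comb \<beta> (a \<beta>) x)\<^sup>2)
        \<le> 3 * 4 ^ k * ((4 / 3 * n) * (\<Sum>\<beta>\<in>?M. 4 ^ (max_index \<beta> - k) * q \<beta>))"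
      by (rule mult_left_mono) simp
    also have "\<dots> = 4 * n * (\<Sum>\<beta>\<in>?M. 4 ^ k * (4 ^ (max_index \<beta> - k) * q \<beta>))"
      by (simp add: sum_distrib_left ac_simps)
    \<comment> \<open>The weights were chosen so that, with the factor \<open>4 ^ k\<close> of the
      derivative, they give exactly the weight \<open>4 ^ max_index \<beta>\<close> of the stability
      inequality.\<close>
    also have "(\<Sum>\<beta>\<in>?M. 4 ^ k * (4 ^ (max_index \<beta> - k) * q \<beta>)) = (\<Sum>\<beta>\<in>?M. 4 ^ max_index \<beta> * q \<beta>)"
    proof (rule sum.cong[OF refl])
      fix \<beta> assume "\<beta> \<in> ?M"
      then have "k \<le> max_index \<beta>" using max_index_ge[of \<beta> i] by simp
      then have "(4::real) ^ max_index \<beta> = 4 ^ k * 4 ^ (max_index \<beta> - k)"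
        by (simp flip: power_add)
      then show "4 ^ k * (4 ^ (max_index \<beta> - k) * q \<beta>) = 4 ^ max_index \<beta> * q \<beta>" by simp
    qed
    finally show ?thesis .
  qed
  have "(H10_norm (\<lambda>x. \<Sum>\<beta>\<in>\<Lambda>. s \<beta> x))\<^sup>2 = (H10_norm (\<lambda>x. \<Sum>\<beta>\<in>\<Lambda>. block_comb \<beta> (a \<beta>) x))\<^sup>2"
    using s by (simp cong: sum.cong)
  also have "\<dots> = (\<Sum>i\<in>UNIV. \<Sum>k\<in>(\<lambda>\<beta>. \<beta> i) ` \<Lambda>.
      3 * 4 ^ k * (LINT x|lborel. (\<Sum>\<beta>\<in>{\<beta>\<in>\<Lambda>. \<beta> i = k}. block_comb \<beta> (a \<beta>) x)\<^sup>2))"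
    by (simp only: H10_norm_block_sum[OF assms] block_deriv_sum_norm[OF assms])
  also have "\<dots> \<le> (\<Sum>i\<in>UNIV. \<Sum>k\<in>(\<lambda>\<beta>. \<beta> i) ` \<Lambda>. 4 * n * (\<Sum>\<beta>\<in>{\<beta>\<in>\<Lambda>. \<beta> i = k}. 4 ^ max_index \<beta> * q \<beta>))"
    by (intro sum_mono layer)
  \<comment> \<open>For fixed \<open>i\<close> the level sets of \<open>\<beta> i\<close> partition
    \<open>\<Lambda>\<close>, so every direction contributes the same full sum.\<close>
  also have "\<dots> = (\<Sum>i\<in>(UNIV :: 'd set). 4 * n * (\<Sum>\<beta>\<in>\<Lambda>. 4 ^ max_index \<beta> * q \<beta>))"
    by (simp only: sum.image_gen[OF assms(1), symmetric] sum_distrib_left[symmetric])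
  also have "\<dots> = 4 * real CARD('d) * n * (\<Sum>\<beta>\<in>\<Lambda>. 4 ^ max_index \<beta> * q \<beta>)"
    by simp
  also have "(\<Sum>\<beta>\<in>\<Lambda>. 4 ^ max_index \<beta> * q \<beta>) = (\<Sum>\<beta>\<in>\<Lambda>. 2 ^ (2 * max_index \<beta>) * (L2_norm (s \<beta>))\<^sup>2)"
    by (intro sum.cong refl) (use assms(2) in \<open>auto simp: s q_def L2_norm_block_comb power_mult subset_iff\<close>)
  finally show "(H10_norm (\<lambda>x. \<Sum>\<beta>\<in>\<Lambda>. s \<beta> x))\<^sup>2 \<le> 4 * real CARD('d) * real (max_layer_card \<Lambda>) *
      (\<Sum>\<beta>\<in>\<Lambda>. 2 ^ (2 * max_index \<beta>) * (L2_norm (s \<beta>))\<^sup>2)"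
    by (simp add: n_def)
qed

section \<open>Lower bound from full block sums\<close>

text \<open>Jensen's inequality on a cube of volume 1, obtained by expanding the nonnegative
  variance about the mean \<open>c\<close>.\<close>

lemma square_integral_le:
  fixes f :: "real ^ 'd::finite \<Rightarrow> real"
  assumes "integrable lborel f" "integrable lborel (\<lambda>x. (f x)\<^sup>2)" "\<And>x. x \<notin> unit_cube \<Longrightarrow> f x = 0"
  shows "(LINT x|lborel. f x)\<^sup>2 \<le> (LINT x|lborel. (f x)\<^sup>2)"
proof -
  define c where "c = (LINT x|lborel. f x)"
  have vol: "measure lborel (unit_cube :: (real ^ 'd) set) = 1"
    unfolding unit_cube_def by (subst content_cbox_cart) (auto simp: interval_ne_empty_cart)
  have ind: "integrable lborel (indicator unit_cube :: real ^ 'd \<Rightarrow> real)"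
    unfolding unit_cube_def by (intro integrable_real_indicator emeasure_lborel_cbox_finite) simp
  have "0 \<le> (LINT x|lborel. (f x - c * indicator unit_cube x)\<^sup>2)"
    by simp
  also have "(\<lambda>x. (f x - c * indicator unit_cube x)\<^sup>2) =
      (\<lambda>x. (f x)\<^sup>2 - 2 * c * f x + c\<^sup>2 * indicator unit_cube x)"
    using assms(3) by (auto simp: fun_eq_iff indicator_def power2_eq_square algebra_simps)
  also have "(LINT x|lborel. (f x)\<^sup>2 - 2 * c * f x + c\<^sup>2 * indicator unit_cube x) =
      (LINT x|lborel. (f x)\<^sup>2) - 2 * c * c + c\<^sup>2"
    using assms ind vol by (simp add: c_def)
  finally show ?thesis
    by (simp add: c_def power2_eq_square)
qed

text \<open>Level \<open>k\<close> has \<open>2 ^ (k - 1)\<close> functions, each with integral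
  \<open>1 / 2 ^ k\<close> and squared norm \<open>2 / 3 / 2 ^ k\<close>, and their products vanish.
  Both totals are therefore independent of \<open>k\<close>.\<close>

lemma level_sum_integrable_integral:
  assumes "k \<ge> 1"
  shows "integrable lborel (\<lambda>t. \<Sum>n\<in>level_indices k. faber n t)"
    and "(LINT t|lborel. (\<Sum>n\<in>level_indices k. faber n t)) = 1 / 2"
    and "integrable lborel (\<lambda>t. (\<Sum>n\<in>level_indices k. faber n t) * (\<Sum>n\<in>level_indices k. faber n t))"
    and "(LINT t|lborel. (\<Sum>n\<in>level_indices k. faber n t) * (\<Sum>n\<in>level_indices k. faber n t)) = 1 / 3"
proof -
  obtain m where k: "k = Suc m" using assms by (cases k) auto
  have card: "card (level_indices k) = 2 ^ m"
    by (simp add: level_indices_def k)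
  have fin: "finite (level_indices k)"
    by (simp add: level_indices_def)
  have lev: "faber_level n = k" "n \<ge> 1" if "n \<in> level_indices k" for n
    using level_indices_faber_level[OF that assms] that
    by (auto simp: level_indices_def intro: order_trans[of _ "2 ^ (k - 1)"])
  show "integrable lborel (\<lambda>t. \<Sum>n\<in>level_indices k. faber n t)"
    by (intro Bochner_Integration.integrable_sum faber_integrable_integral)
  show "(LINT t|lborel. (\<Sum>n\<in>level_indices k. faber n t)) = 1 / 2"
    using card by (simp add: faber_integrable_integral lev) (simp add: k)
  show "integrable lborel (\<lambda>t. (\<Sum>n\<in>level_indices k. faber n t) * (\<Sum>n\<in>level_indices k. faber n t))"
    unfolding sum_product by (intro Bochner_Integration.integrable_sum faber_mult_integrable)
  have "(\<Sum>n\<in>level_indices k. faber n t) * (\<Sum>n\<in>level_indices k. faber n t) =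
      (\<Sum>n\<in>level_indices k. faber n t * faber n t)" for t
  proof -
    have "(\<Sum>n\<in>level_indices k. faber m t * faber n t) = faber m t * faber m t"
      if "m \<in> level_indices k" for m
    proof -
      have "(\<Sum>n\<in>level_indices k. faber m t * faber n t) = (\<Sum>n\<in>{m}. faber m t * faber n t)"
      proof (rule sum.mono_neutral_right[OF fin])
        show "\<forall>n\<in>level_indices k - {m}. faber m t * faber n t = 0"
          using same_level_disjoint(1)[of m] lev that by force
      qed (use that in auto)
      then show ?thesis by simp
    qed
    then show ?thesis unfolding sum_product by simp
  qed
  then show "(LINT t|lborel. (\<Sum>n\<in>level_indices k. faber n t) * (\<Sum>n\<in>level_indices k. faber n t)) = 1 / 3"
    using card by (simp add: faber_integrable_integral faber_mult_integrable lev) (simp add: k)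
qed

text \<open>The index set of a block is a box, so the sum of all its products factorises.\<close>

lemma block_comb_one:
  "block_comb \<beta> (\<lambda>_. 1) x = (\<Prod>i\<in>UNIV. \<Sum>n\<in>level_indices (\<beta> i). faber n (x $ i))"
proof -
  have "block_indices \<beta> = PiE UNIV (\<lambda>i. level_indices (\<beta> i))"
    by (auto simp: block_indices_def PiE_def Pi_def)
  then show ?thesis
    unfolding block_comb_def tensor_faber_def by (simp add: prod_sum_PiE level_indices_def)
qed

text \<open>The values do not depend on \<open>\<beta>\<close>; the squared mean divided by the
  squared norm is \<open>(3 / 4) ^ CARD('d)\<close>, the source of that factor in the lower
  bound.\<close>

lemma block_comb_one_integrable_integral:
  fixes \<beta> :: "'d::finite \<Rightarrow> nat"
  assumes "\<beta> \<in> multi_indices"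
  shows "integrable lborel (block_comb \<beta> (\<lambda>_. 1))"
    and "(LINT x|lborel. block_comb \<beta> (\<lambda>_. 1) x) = (1 / 2) ^ CARD('d)"
    and "(LINT x|lborel. block_comb \<beta> (\<lambda>_. 1) x * block_comb \<beta> (\<lambda>_. 1) x) = (1 / 3) ^ CARD('d)"
proof -
  have b: "1 \<le> \<beta> i" for i
    using assms by (simp add: multi_indices_def)
  show "integrable lborel (block_comb \<beta> (\<lambda>_. 1))"
    unfolding block_comb_one[abs_def]
    by (rule lborel_cart_prod(1)[where f = "\<lambda>i t. \<Sum>n\<in>level_indices (\<beta> i). faber n t"])
       (rule level_sum_integrable_integral[OF b])
  show "(LINT x|lborel. block_comb \<beta> (\<lambda>_. 1) x) = (1 / 2) ^ CARD('d)"
    unfolding block_comb_one[abs_def]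
    by (subst lborel_cart_prod(2)[where f = "\<lambda>i t. \<Sum>n\<in>level_indices (\<beta> i). faber n t"])
       (simp_all only: level_sum_integrable_integral[OF b] prod_constant)
  show "(LINT x|lborel. block_comb \<beta> (\<lambda>_. 1) x * block_comb \<beta> (\<lambda>_. 1) x) = (1 / 3) ^ CARD('d)"
    unfolding block_comb_one[abs_def] prod.distrib[symmetric]
    by (subst lborel_cart_prod(2)[where f = "\<lambda>i t. (\<Sum>n\<in>level_indices (\<beta> i). faber n t)
          * (\<Sum>n\<in>level_indices (\<beta> i). faber n t)"])
       (simp_all only: level_sum_integrable_integral[OF b] prod_constant)
qed

text \<open>With \<open>N\<close> test blocks the left side grows like \<open>N\<^sup>2\<close> by
  Jensen and the right side like \<open>N\<close>; the division by \<open>CARD('d)\<close> is the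
  loss in choosing one direction.\<close>

lemma stability_constant_lower:
  fixes \<Lambda> :: "('d::finite \<Rightarrow> nat) set"
  assumes "finite \<Lambda>" "\<Lambda> \<noteq> {}" "\<Lambda> \<subseteq> multi_indices" "stability_constant \<Lambda> K"
  shows "3 * (3 / 4) ^ CARD('d) / real CARD('d) * real (max_layer_card \<Lambda>) \<le> K"
proof -
  obtain k where k: "card (index_layer \<Lambda> k) = max_layer_card \<Lambda>" "max_layer_card \<Lambda> > 0"
    using max_layer_attained assms by metis
  define L where "L i = {\<beta>\<in>index_layer \<Lambda> k. \<beta> i = k}" for i
  have fin: "finite (L i)" and sub: "L i \<subseteq> \<Lambda>" for i
    using assms(1) by (auto simp: L_def index_layer_def)
  \<comment> \<open>Pigeonhole: each index of the layer attains its maximum \<open>k\<close> in some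
    coordinate, so the \<open>CARD('d)\<close> sets \<open>L i\<close> cover the layer.\<close>
  have "\<exists>i. max_layer_card \<Lambda> \<le> CARD('d) * card (L i)"
  proof (rule ccontr)
    assume "\<not> ?thesis"
    then have lt: "CARD('d) * card (L i) < max_layer_card \<Lambda>" for i
      by (simp add: not_le)
    have "index_layer \<Lambda> k = (\<Union>i. L i)"
      by (auto simp: L_def index_layer_def) (metis max_index_attained)
    then have "max_layer_card \<Lambda> \<le> (\<Sum>i\<in>UNIV. card (L i))"
      using card_UN_le[of UNIV L] k(1) by simp
    then have "CARD('d) * max_layer_card \<Lambda> \<le> (\<Sum>i\<in>(UNIV::'d set). CARD('d) * card (L i))"
      by (simp flip: sum_distrib_left)
    also have "\<dots> < (\<Sum>i\<in>(UNIV::'d set). max_layer_card \<Lambda>)"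
      by (rule sum_strict_mono) (use lt in auto)
    finally show False by simp
  qed
  then obtain i where i: "max_layer_card \<Lambda> \<le> CARD('d) * card (L i)" ..
  define M where "M = L i"
  define N where "N = real (card M)"
  have N: "0 < N"
    using i k(2) by (cases "card (L i)") (auto simp: N_def M_def)
  have iN: "real (max_layer_card \<Lambda>) \<le> real CARD('d) * N"
    unfolding N_def M_def using i by (simp flip: of_nat_mult)
  have M: "finite M" "M \<subseteq> \<Lambda>" "M \<subseteq> multi_indices"
    and Mk: "\<And>\<beta>. \<beta> \<in> M \<Longrightarrow> max_index \<beta> = k" "\<And>\<beta>. \<beta> \<in> M \<Longrightarrow> \<beta> i = k"
    using fin[of i] sub[of i] assms(3) by (auto simp: M_def L_def index_layer_def)
  \<comment> \<open>Zero coefficients outside \<open>M\<close> leave only the blocks of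
    \<open>M\<close> on both sides of the inequality.\<close>
  define a :: "('d \<Rightarrow> nat) \<Rightarrow> ('d \<Rightarrow> nat) \<Rightarrow> real" where "a \<beta> = (\<lambda>_. if \<beta> \<in> M then 1 else 0)" for \<beta>
  have comb: "block_comb \<beta> (a \<beta>) = (if \<beta> \<in> M then block_comb \<beta> (\<lambda>_. 1) else (\<lambda>_. 0))" for \<beta>
    by (simp add: a_def block_comb_def fun_eq_iff)
  let ?u = "\<lambda>x. \<Sum>\<beta>\<in>M. block_comb \<beta> (\<lambda>_. 1) x"
  have restrict: "(\<Sum>\<beta>\<in>{\<beta>\<in>\<Lambda>. \<beta> i = k}. block_comb \<beta> (a \<beta>) x) = ?u x" for x
  proof -
    have "(\<Sum>\<beta>\<in>{\<beta>\<in>\<Lambda>. \<beta> i = k}. block_comb \<beta> (a \<beta>) x) = (\<Sum>\<beta>\<in>M. block_comb \<beta> (a \<beta>) x)"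
      using assms(1) M Mk by (intro sum.mono_neutral_right) (auto simp: comb)
    then show ?thesis by (simp add: comb cong: sum.cong)
  qed
  have "(LINT x|lborel. ?u x) = N * (1 / 2) ^ CARD('d)"
    using M(3) block_comb_one_integrable_integral[where 'd = 'd]
    by (subst Bochner_Integration.integral_sum) (auto simp: N_def subset_iff)
  moreover have "(LINT x|lborel. ?u x)\<^sup>2 \<le> (LINT x|lborel. (?u x)\<^sup>2)"
    using M(3) block_comb_one_integrable_integral[where 'd = 'd]
    by (intro square_integral_le)
       (auto simp: power2_eq_square sum_product subset_iff block_eq_0_outside
         intro!: Bochner_Integration.integrable_sum block_mult_integrable sum.neutral)
  ultimately have "3 * 4 ^ k * (N * (1 / 2) ^ CARD('d))\<^sup>2 \<le> 3 * 4 ^ k * (LINT x|lborel. (?u x)\<^sup>2)"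
    by simp
  also have "\<dots> = 3 * 4 ^ k * (LINT x|lborel. (\<Sum>\<beta>\<in>{\<beta>\<in>\<Lambda>. \<beta> i = k}. block_comb \<beta> (a \<beta>) x)\<^sup>2)"
    by (simp only: restrict)
  \<comment> \<open>Of the nonnegative level terms only level \<open>k\<close> is kept, and in the
    next step only direction \<open>i\<close>.\<close>
  also have "\<dots> \<le> (LINT x|lborel. (\<Sum>\<beta>\<in>\<Lambda>. block_deriv i \<beta> (a \<beta>) x)\<^sup>2)"
  proof -
    obtain \<beta> where "\<beta> \<in> M" using N by (auto simp: N_def card_gt_0_iff)
    then have "k \<in> (\<lambda>\<beta>. \<beta> i) ` \<Lambda>" using M(2) Mk(2) by blast
    then show ?thesis
      unfolding block_deriv_sum_norm[OF assms(1,3)] using assms(1)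
      by (intro member_le_sum[where f = "\<lambda>k. 3 * 4 ^ k *
            (LINT x|lborel. (\<Sum>\<beta>\<in>{\<beta>\<in>\<Lambda>. \<beta> i = k}. block_comb \<beta> (a \<beta>) x)\<^sup>2)"]) auto
  qed
  also have "\<dots> \<le> (\<Sum>i\<in>UNIV. LINT x|lborel. (\<Sum>\<beta>\<in>\<Lambda>. block_deriv i \<beta> (a \<beta>) x)\<^sup>2)"
    by (rule member_le_sum[where f = "\<lambda>i. LINT x|lborel. (\<Sum>\<beta>\<in>\<Lambda>. block_deriv i \<beta> (a \<beta>) x)\<^sup>2"]) auto
  also have "\<dots> = (H10_norm (\<lambda>x. \<Sum>\<beta>\<in>\<Lambda>. block_comb \<beta> (a \<beta>) x))\<^sup>2"
    by (rule H10_norm_block_sum[OF assms(1,3), symmetric])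
  also have "\<dots> \<le> K * (\<Sum>\<beta>\<in>\<Lambda>. 2 ^ (2 * max_index \<beta>) * (L2_norm (block_comb \<beta> (a \<beta>)))\<^sup>2)"
    using assms(4) unfolding stability_constant_def by (auto simp: block_space_eq)
  also have "(\<Sum>\<beta>\<in>\<Lambda>. 2 ^ (2 * max_index \<beta>) * (L2_norm (block_comb \<beta> (a \<beta>)))\<^sup>2) =
      (\<Sum>\<beta>\<in>M. 4 ^ k * (1 / 3) ^ CARD('d))"
    using assms(1,3) M Mk
    by (intro sum.mono_neutral_cong_right)
       (auto simp: L2_norm_block_comb comb L2_norm_def[of "\<lambda>_. 0"] block_comb_one_integrable_integral power_mult subset_iff)
  also have "\<dots> = N * (4 ^ k * (1 / 3) ^ CARD('d))"
    by (simp add: N_def)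
  finally have "3 * 4 ^ k * (N * (1 / 2) ^ CARD('d))\<^sup>2 \<le> K * (N * (4 ^ k * (1 / 3) ^ CARD('d)))" .
  moreover have "3 * 4 ^ k * (N * (1 / 2) ^ CARD('d))\<^sup>2 =
      (3 * (3 / 4) ^ CARD('d) * N) * (N * (4 ^ k * (1 / 3) ^ CARD('d)))"
  proof -
    have "((1 / 2) ^ CARD('d))\<^sup>2 = (1 / 4 :: real) ^ CARD('d)"
      by (simp add: power2_eq_square flip: power_mult_distrib)
    also have "\<dots> = (3 / 4) ^ CARD('d) * (1 / 3) ^ CARD('d)"
      by (simp flip: power_mult_distrib)
    finally show ?thesis by (simp add: power_mult_distrib power2_eq_square ac_simps)
  qed
  \<comment> \<open>The common factor \<open>N * (4 ^ k * (1 / 3) ^ CARD('d))\<close> is positive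
    and cancels.\<close>
  ultimately have "3 * (3 / 4) ^ CARD('d) * N \<le> K"
    using N by (simp add: mult_le_cancel_right)
  moreover have "3 * (3 / 4) ^ CARD('d) / real CARD('d) * real (max_layer_card \<Lambda>) \<le>
      3 * (3 / 4) ^ CARD('d) / real CARD('d) * (real CARD('d) * N)"
    by (rule mult_left_mono[OF iN]) simp
  ultimately show ?thesis by simp
qed

section \<open>Existence of the best constant and conclusion\<close>

text \<open>For each fixed \<open>s\<close> the condition on the constant is a closed half-line or
  no restriction at all, so the infimum of the admissible constants is itself admissible.\<close>

lemma best_constant_exists:
  assumes "stability_constant \<Lambda> K" "\<And>K'. stability_constant \<Lambda> K' \<Longrightarrow> c \<le> K'"
  obtains K0 where "best_constant \<Lambda> K0"
proof
  define S where "S = Collect (stability_constant \<Lambda>)"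
  have bdd: "bdd_below S" using assms(2) by (intro bdd_belowI[of _ c]) (simp add: S_def)
  have ne: "S \<noteq> {}" using assms(1) by (auto simp: S_def)
  show "best_constant \<Lambda> (Inf S)"
    unfolding best_constant_def
  proof
    show "\<forall>K'. stability_constant \<Lambda> K' \<longrightarrow> Inf S \<le> K'"
      using bdd by (auto simp: S_def intro: cInf_lower)
    show "stability_constant \<Lambda> (Inf S)"
      unfolding stability_constant_def
    proof (intro allI impI)
      fix s assume s: "\<forall>\<beta>\<in>\<Lambda>. s \<beta> \<in> block_space \<beta>"
      let ?H = "(H10_norm (\<lambda>x. \<Sum>\<beta>\<in>\<Lambda>. s \<beta> x))\<^sup>2"
      let ?R = "\<Sum>\<beta>\<in>\<Lambda>. 2 ^ (2 * max_index \<beta>) * (L2_norm (s \<beta>))\<^sup>2"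
      have le: "?H \<le> K' * ?R" if "K' \<in> S" for K'
        using that s unfolding S_def stability_constant_def by blast
      have "0 \<le> ?R" by (intro sum_nonneg) auto
      then consider "?R = 0" | "?R > 0" by linarith
      then show "?H \<le> Inf S * ?R"
      proof cases
        case 1
        \<comment> \<open>Some admissible constant exists, and with \<open>?R = 0\<close> it already
          forces \<open>?H \<le> 0\<close>.\<close>
        then show ?thesis using le ne by auto
      next
        case 2
        then have "?H / ?R \<le> Inf S"
          using le ne by (intro cInf_greatest) (auto simp: pos_divide_le_eq)
        with 2 show ?thesis by (simp add: pos_divide_le_eq)
      qed
    qed
  qed
qed

theorem mainTheorem2:
  assumes "CARD('d::finite) > 1"
  shows "\<exists>c > 0. \<exists>C > 0. \<forall>\<Lambda> :: ('d \<Rightarrow> nat) set.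
           finite \<Lambda> \<longrightarrow> \<Lambda> \<noteq> {} \<longrightarrow> monotone_index_set \<Lambda> \<longrightarrow>
             (\<exists>C\<^sub>\<Lambda>. best_constant \<Lambda> C\<^sub>\<Lambda> \<and>
                c * real (max_layer_card \<Lambda>) \<le> C\<^sub>\<Lambda> \<and>
                C\<^sub>\<Lambda> \<le> C * real (max_layer_card \<Lambda>))"
proof (rule exI[of _ "3 * (3 / 4) ^ CARD('d) / real CARD('d)"], intro conjI,
    simp, rule exI[of _ "4 * real CARD('d)"], intro conjI allI impI)
  fix \<Lambda> :: "('d \<Rightarrow> nat) set"
  assume \<Lambda>: "finite \<Lambda>" "\<Lambda> \<noteq> {}" "monotone_index_set \<Lambda>"
  then have sub: "\<Lambda> \<subseteq> multi_indices"
    by (simp add: monotone_index_set_def)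
  note upper = stability_constantI_upper[OF \<Lambda>(1) sub]
    and lower = stability_constant_lower[OF \<Lambda>(1,2) sub]
  obtain K where K: "best_constant \<Lambda> K"
    using best_constant_exists[OF upper lower] by blast
  \<comment> \<open>\<open>K\<close> is admissible, so the lower bound applies to it; it is the
    least admissible constant, so it lies below the one from the upper bound.\<close>
  with upper lower show "\<exists>C\<^sub>\<Lambda>. best_constant \<Lambda> C\<^sub>\<Lambda> \<and>
      3 * (3 / 4) ^ CARD('d) / real CARD('d) * real (max_layer_card \<Lambda>) \<le> C\<^sub>\<Lambda> \<and>
      C\<^sub>\<Lambda> \<le> 4 * real CARD('d) * real (max_layer_card \<Lambda>)"
    unfolding best_constant_def by blast
qed simp

end
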